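(* Let $n \ge 5$ and let $f$ be a nice mechanism for the two-facility game on the real line with $n$ agents. Then for every location profile $\mathbf{x} = (x_1,\dots,x_n) \in \mathbb{R}^n$, writing $f(\mathbf{x}) = \{l_1, l_2\}$, at least one of the following holds: there exists $l \in f(\mathbf{x})$ with $l \ge \max \mathbf{x}$ or $l \le \min \mathbf{x}$; or $l_1 = l_2$.
   Context: Two-facility game on a line: there are $n$ agents $N=\{1,\dots,n\}$, agent $i$ having location $x_i \in \mathbb{R}$; a location profile is $\mathbf{x}=(x_1,\dots,x_n)$, with $\min\mathbf{x}$ and $\max\mathbf{x}$ the smallest and largest coordinates. A deterministic mechanism is a function $f$ mapping each reported profile $\mathbf{x}\in\mathbb{R}^n$ to a pair of facility locations $f(\mathbf{x})=\{l_1,l_2\}$ (possibly $l_1=l_2$). The cost of an agent at $y$ is $\mathrm{cost}(\{l_1,l_2\},y)=\min\{|l_1-y|,|l_2-y|\}$. The social cost is $SC(f,\mathbf{x})=\sum_{i=1}^n \mathrm{cost}(f(\mathbf{x}),x_i)$, and $OPT(\mathbf{x})=\min_{l_1,l_2\in\mathbb{R}}\sum_{i}\mathrm{cost}(\{l_1,l_2\},x_i)$. The mechanism $f$ is strategy-proof if for every agent $i$, every profile $\mathbf{x}=\langle x_i,\mathbf{x}_{-i}\rangle$ and every $x_i'\in\mathbb{R}$, $\mathrm{cost}(f(x_i,\mathbf{x}_{-i}),x_i)\le \mathrm{cost}(f(x_i',\mathbf{x}_{-i}),x_i)$. It has bounded approximation ratio if there is a finite $\gamma$ with $SC(f,\mathbf{x})\le\gamma\,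 OPT(\mathbf{x})$ for all $\mathbf{x}$. A mechanism is nice if it is deterministic, strategy-proof, and has bounded approximation ratio. *)

theory Defs
  imports Complex_Main
begin

text \<open>A location profile for n agents is a real list of length n (agent i at xs ! i, i < n).
  A deterministic mechanism maps profiles to a pair of facility locations (l1, l2),
  read as the (multi)set {l1, l2}.\<close>

definition fcost :: "real \<times> real \<Rightarrow> real \<Rightarrow> real" where
  "fcost L y = min \<bar>fst L - y\<bar> \<bar>snd L - y\<bar>"

definition social_cost :: "(real list \<Rightarrow> real \<times> real) \<Rightarrow> real list \<Rightarrow> real" where
  "social_cost f xs = (\<Sum>i<length xs. fcost (f xs) (xs ! i))"

definition OPT :: "real list \<Rightarrow> real" where
  "OPT xs = Inf {(\<Sum>i<length xs. fcost (l1, l2) (xs ! i)) | l1 l2. True}"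

definition strategy_proof :: "nat \<Rightarrow> (real list \<Rightarrow> real \<times> real) \<Rightarrow> bool" where
  "strategy_proof n f \<longleftrightarrow>
     (\<forall>xs. length xs = n \<longrightarrow> (\<forall>i<n. \<forall>y::real.
        fcost (f xs) (xs ! i) \<le> fcost (f (xs[i := y])) (xs ! i)))"

definition bounded_approx :: "nat \<Rightarrow> (real list \<Rightarrow> real \<times> real) \<Rightarrow> bool" where
  "bounded_approx n f \<longleftrightarrow>
     (\<exists>\<gamma>::real. \<forall>xs. length xs = n \<longrightarrow> social_cost f xs \<le> \<gamma> * OPT xs)"

definition nice :: "nat \<Rightarrow> (real list \<Rightarrow> real \<times> real) \<Rightarrow> bool" where
  "nice n f \<longleftrightarrow> strategy_proof n f \<and> bounded_approx n f"

end

(* Call a group of agents decisive if, for some partition into three groups standing at three points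
   of the line, it stands in the middle and gets a facility at its location. An agent who moves onto
   a facility keeps it there; so if l1 < l2 are both strictly inside the range of a profile, moving
   everybody except one agent on either side of l1 (or l2) onto it exhibits a decisive group.

   For three groups, decisiveness at one profile propagates to all profiles in which one outer group
   is far away: the outer neighbour of a decisive group has a hole in its option set, whose length is
   bounded below by the approximation ratio. Two groups cannot both be decisive with respect to each
   other and the same extreme group, since their holes would have to halve indefinitely.

   Hence outer agents may be redistributed between the two sides, and a minimal decisive set is a
   singleton {d}: otherwise, splitting it in two ways, with an outer group crossing over to a facility
   in the middle, gives two mutually exclusive decisive sets (this needs five agents). Finally, d lies
   left of l2 or right of l1, and moving everybody except d and an extreme agent to that facility gives
   a decisive group which excludes d. *)

theory Submission
  imports Defs "HOL-Analysis.Analysis"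
begin

section \<open>Facility pairs, costs and reflection of the line\<close>

definition on :: "real \<times> real \<Rightarrow> real \<Rightarrow> bool" where
  "on L y \<longleftrightarrow> fst L = y \<or> snd L = y"

lemma fcost_nonneg: "0 \<le> fcost L y"
  by (simp add: fcost_def)

lemma fcost_eq_0: "fcost L y = 0 \<longleftrightarrow> on L y"
  by (auto simp: fcost_def on_def min_def)

lemma fcost_le_0: "fcost L y \<le> 0 \<longleftrightarrow> on L y"
  using fcost_nonneg[of L y] fcost_eq_0[of L y] by linarith

lemma fcost_le: "on L l \<Longrightarrow> fcost L y \<le> \<bar>l - y\<bar>"
  by (auto simp: fcost_def on_def)

lemma fcost_attained: "\<exists>l. on L l \<and> fcost L y = \<bar>l - y\<bar>"
  by (auto simp: fcost_def on_def min_def)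

lemma on_two: "on L a \<Longrightarrow> on L b \<Longrightarrow> a \<noteq> b \<Longrightarrow> on L c \<Longrightarrow> c = a \<or> c = b"
  by (auto simp: on_def)

definition neg :: "real \<times> real \<Rightarrow> real \<times> real" where
  "neg L = (- fst L, - snd L)"

lemma on_neg [simp]: "on (neg L) y \<longleftrightarrow> on L (- y)"
  by (auto simp: on_def neg_def)

lemma fcost_neg [simp]: "fcost (neg L) y = fcost L (- y)"
  by (simp add: fcost_def neg_def min_def abs_minus_commute) linarith

section \<open>A single strategic agent\<close>

definition sp1 :: "(real \<Rightarrow> real \<times> real) \<Rightarrow> bool" where
  "sp1 H \<longleftrightarrow> (\<forall>c c'. fcost (H c) c \<le> fcost (H c') c)"

text \<open>Otherwise the agent at \<open>y\<close> would gain by reporting \<open>c\<close>. Hence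
  \<open>{y. on (H y) y}\<close> is the option set: all points reachable by some report.\<close>

lemma sp1_on: "sp1 H \<Longrightarrow> on (H c) y \<Longrightarrow> on (H y) y"
  by (metis sp1_def fcost_le_0 fcost_eq_0)

lemma sp1_cost: "sp1 H \<Longrightarrow> on (H l) l \<Longrightarrow> fcost (H c) c \<le> \<bar>l - c\<bar>"
  by (metis sp1_def fcost_le order_trans)

lemma sp1_closed:
  assumes "sp1 H" shows "closed {y. on (H y) y}"
  unfolding closed_sequential_limits
proof (intro allI impI, elim conjE)
  fix s l assume s: "\<forall>n::nat. s n \<in> {y. on (H y) y}" and l: "s \<longlonglongrightarrow> l"
  have "(\<lambda>n. \<bar>s n - l\<bar>) \<longlonglongrightarrow> 0"
    by (rule tendsto_rabs_zero[OF LIM_zero[OF l]])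
  moreover have "fcost (H l) l \<le> \<bar>s n - l\<bar>" for n
    using s sp1_cost[OF assms] by simp
  ultimately have "fcost (H l) l \<le> 0"
    by (meson LIMSEQ_le_const)
  then show "l \<in> {y. on (H y) y}" by (simp add: fcost_le_0)
qed

text \<open>Since the option set is closed, the nearest options on both sides of \<open>b\<close>
  are attained.\<close>

lemma sp1_hole:
  assumes H: "sp1 H" and g0: "on (H g0) g0" and v0: "on (H v0) v0"
    and b: "g0 < b" "b < v0" "\<not> on (H b) b"
  obtains g v where "g0 \<le> g" "g < b" "b < v" "v \<le> v0" "on (H g) g" "on (H v) v"
    "\<And>y. g < y \<Longrightarrow> y < v \<Longrightarrow> \<not> on (H y) y"
proof -
  let ?I = "{y. on (H y) y}"
  let ?L = "?I \<inter> {..b}" and ?R = "?I \<inter> {b..}"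
  have cl: "closed ?L" "closed ?R"
    using sp1_closed[OF H] by (auto intro: closed_Int)
  have bL: "bdd_above ?L" and bR: "bdd_below ?R" by auto
  have gL: "g0 \<in> ?L" and vR: "v0 \<in> ?R" using assms by auto
  have g: "Sup ?L \<in> ?L" using closed_contains_Sup[OF _ bL cl(1)] gL by blast
  have v: "Inf ?R \<in> ?R" using closed_contains_Inf[OF _ bR cl(2)] vR by blast
  show thesis
  proof (rule that[of "Sup ?L" "Inf ?R"])
    show "g0 \<le> Sup ?L" using cSup_upper[OF gL bL] .
    show "Inf ?R \<le> v0" using cInf_lower[OF vR bR] .
    show "Sup ?L < b" using g b(3) by (auto simp: less_le)
    show "b < Inf ?R" using v b(3) by (auto simp: less_le)
    show "on (H (Sup ?L)) (Sup ?L)" "on (H (Inf ?R)) (Inf ?R)" using g v by auto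
    fix y assume y: "Sup ?L < y" "y < Inf ?R"
    show "\<not> on (H y) y"
    proof
      assume "on (H y) y"
      then have "y \<in> ?L \<or> y \<in> ?R" by auto
      then show False using y cSup_upper[OF _ bL, of y] cInf_lower[OF _ bR, of y] by force
    qed
  qed
qed

text \<open>The nearest facility is an option within \<open>v - c\<close> of \<open>c\<close>; as
  \<open>c\<close> is in the right half of the hole, only \<open>v\<close> qualifies.\<close>

lemma sp1_right:
  assumes H: "sp1 H" and v: "on (H v) v" and "g < v"
    and hole: "\<And>y. g < y \<Longrightarrow> y < v \<Longrightarrow> \<not> on (H y) y" and c: "(g + v) / 2 < c" "c \<le> v"
  shows "on (H c) v"
proof -
  obtain l where l: "on (H c) l" "fcost (H c) c = \<bar>l - c\<bar>" using fcost_attained by blast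
  have "\<bar>l - c\<bar> \<le> v - c" using sp1_cost[OF H v, of c] l c by simp
  then have "g < l" "l \<le> v" using c by (auto simp: field_simps abs_le_iff)
  then show ?thesis using hole[of l] sp1_on[OF H l(1)] l by (cases "l = v") auto
qed

lemma sp1_left:
  assumes H: "sp1 H" and g: "on (H g) g" and "g < v"
    and hole: "\<And>y. g < y \<Longrightarrow> y < v \<Longrightarrow> \<not> on (H y) y" and c: "c < (g + v) / 2" "g \<le> c"
  shows "on (H c) g"
proof -
  obtain l where l: "on (H c) l" "fcost (H c) c = \<bar>l - c\<bar>" using fcost_attained by blast
  have "\<bar>l - c\<bar> \<le> c - g" using sp1_cost[OF H g, of c] l c by simp
  then have "l < v" "g \<le> l" using c by (auto simp: field_simps abs_le_iff)
  then show ?thesis using hole[of l] sp1_on[OF H l(1)] l by (cases "l = g") auto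
qed

section \<open>Three agents\<close>

text \<open>Serving two of the three points by one facility costs at most their distance
  \<open>r\<close>, so the last clause follows from an approximation ratio for the maximum
  cost.\<close>

definition nice3 :: "real \<Rightarrow> (real \<Rightarrow> real \<Rightarrow> real \<Rightarrow> real \<times> real) \<Rightarrow> bool" where
  "nice3 \<Gamma> G \<longleftrightarrow> 1 \<le> \<Gamma> \<and> (\<forall>b c. sp1 (\<lambda>a. G a b c)) \<and> (\<forall>a c. sp1 (\<lambda>b. G a b c)) \<and> (\<forall>a b. sp1 (G a b))
     \<and> (\<forall>a b c. \<forall>y \<in> {a, b, c}. \<forall>r \<in> {\<bar>a - b\<bar>, \<bar>a - c\<bar>, \<bar>b - c\<bar>}. fcost (G a b c) y \<le> \<Gamma> * r)"

text \<open>Reversing the arguments keeps the left-to-right order of the groups.\<close>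

definition refl3 :: "(real \<Rightarrow> real \<Rightarrow> real \<Rightarrow> real \<times> real) \<Rightarrow> real \<Rightarrow> real \<Rightarrow> real \<Rightarrow> real \<times> real" where
  "refl3 G x y z = neg (G (- z) (- y) (- x))"

definition swap3 :: "(real \<Rightarrow> real \<Rightarrow> real \<Rightarrow> real \<times> real) \<Rightarrow> real \<Rightarrow> real \<Rightarrow> real \<Rightarrow> real \<times> real" where
  "swap3 G x y z = G x z y"

definition middle :: "(real \<Rightarrow> real \<Rightarrow> real \<Rightarrow> real \<times> real) \<Rightarrow> bool" where
  "middle G \<longleftrightarrow> (\<exists>a b c. a < b \<and> b < c \<and> on (G a b c) b)"

text \<open>By strategy-proofness a point \<open>y\<close> belongs to some \<open>G a b c\<close> iff it belongs to \<open>G a b y\<close>.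
  The condition therefore says that the option set of the third agent has a hole to the right of \<open>b\<close>.\<close>

definition shield :: "(real \<Rightarrow> real \<Rightarrow> real \<Rightarrow> real \<times> real) \<Rightarrow> real \<Rightarrow> real \<Rightarrow> bool" where
  "shield G a b \<longleftrightarrow> a < b \<and> (\<exists>e>b. \<forall>y. b < y \<longrightarrow> y < e \<longrightarrow> \<not> on (G a b y) y)"

lemma nice3_sp:
  assumes "nice3 \<Gamma> G"
  shows "sp1 (\<lambda>a. G a b c)" "sp1 (\<lambda>b. G a b c)" "sp1 (G a b)"
  using assms by (auto simp: nice3_def)

lemma nice3_ge1: "nice3 \<Gamma> G \<Longrightarrow> 1 \<le> \<Gamma>"
  by (simp add: nice3_def)

lemma nice3_bound:
  assumes "nice3 \<Gamma> G" "y \<in> {a, b, c}" "r \<in> {\<bar>a - b\<bar>, \<bar>a - c\<bar>, \<bar>b - c\<bar>}"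
  shows "fcost (G a b c) y \<le> \<Gamma> * r"
  using assms unfolding nice3_def by blast

lemma nice3_refl:
  assumes "nice3 \<Gamma> G" shows "nice3 \<Gamma> (refl3 G)"
proof -
  have sp: "sp1 (\<lambda>x. neg (H (- x)))" if "sp1 H" for H
    using that unfolding sp1_def by (metis fcost_neg minus_minus)
  show ?thesis
    unfolding nice3_def
  proof (intro conjI allI ballI)
    show "1 \<le> \<Gamma>" using nice3_ge1[OF assms] .
    show "sp1 (\<lambda>a. refl3 G a b c)" for b c :: real
      unfolding refl3_def by (rule sp[OF nice3_sp(3)[OF assms]])
    show "sp1 (\<lambda>b. refl3 G a b c)" for a c :: real
      unfolding refl3_def by (rule sp[OF nice3_sp(2)[OF assms]])
    show "sp1 (refl3 G a b)" for a b :: real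
      unfolding refl3_def by (rule sp[OF nice3_sp(1)[OF assms]])
    fix a b c y r :: real assume "y \<in> {a, b, c}" "r \<in> {\<bar>a - b\<bar>, \<bar>a - c\<bar>, \<bar>b - c\<bar>}"
    then show "fcost (refl3 G a b c) y \<le> \<Gamma> * r"
      unfolding refl3_def fcost_neg
      by (intro nice3_bound[OF assms]) (auto simp: abs_minus_commute)
  qed
qed

lemma nice3_swap:
  assumes "nice3 \<Gamma> G" shows "nice3 \<Gamma> (swap3 G)"
  unfolding nice3_def
proof (intro conjI allI ballI)
  show "1 \<le> \<Gamma>" using nice3_ge1[OF assms] .
  show "sp1 (\<lambda>a. swap3 G a b c)" "sp1 (\<lambda>b. swap3 G a b c)" "sp1 (swap3 G a b)" for a b c :: real
    unfolding swap3_def using nice3_sp[OF assms] by auto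
  fix a b c y r :: real assume "y \<in> {a, b, c}" "r \<in> {\<bar>a - b\<bar>, \<bar>a - c\<bar>, \<bar>b - c\<bar>}"
  then show "fcost (swap3 G a b c) y \<le> \<Gamma> * r"
    unfolding swap3_def by (intro nice3_bound[OF assms]) (auto simp: abs_minus_commute)
qed

lemma refl3_refl3 [simp]: "refl3 (refl3 G) = G"
  by (simp add: refl3_def neg_def fun_eq_iff)

lemma swap3_swap3 [simp]: "swap3 (swap3 G) = G"
  by (simp add: swap3_def fun_eq_iff)

lemma middle_refl: "middle (refl3 G) \<longleftrightarrow> middle G"
proof -
  have "middle (refl3 G)" if mid: "middle G" for G
  proof -
    obtain a b c where "a < b" "b < c" "on (G a b c) b" using mid by (auto simp: middle_def)
    then have "- c < - b \<and> - b < - a \<and> on (refl3 G (- c) (- b) (- a)) (- b)"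
      by (simp add: refl3_def)
    then show ?thesis unfolding middle_def by blast
  qed
  from this[of G] this[of "refl3 G"] show ?thesis by auto
qed

section \<open>Coinciding and well separated groups\<close>

lemma nice3_merge:
  assumes "nice3 \<Gamma> G"
  shows "on (G a b b) a" "on (G a b b) b" "on (G b b a) a" "on (G b b a) b" "on (G b a b) a" "on (G b a b) b"
  using nice3_bound[OF assms, of _ a b b 0] nice3_bound[OF assms, of _ b b a 0] nice3_bound[OF assms, of _ b a b 0]
  by (auto simp flip: fcost_le_0)

text \<open>The bound at \<open>a\<close> keeps one facility too far left to be useful to
  \<open>b\<close> and \<open>c\<close>. Either of these could join the other, so each pays at most
  \<open>c - b\<close>; one facility between them must serve both.\<close>

lemma nice3_separated:
  assumes G: "nice3 \<Gamma> G" and ab: "a < b" "b < c" and sep: "4 * \<Gamma> * (c - b) \<le> b - a"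
  obtains e s where "on (G a b c) e" "on (G a b c) s" "e < 2 * b - c" "b \<le> s" "s \<le> c"
proof -
  have G1: "1 \<le> \<Gamma>" using nice3_ge1[OF G] .
  have cc: "c - b \<le> \<Gamma> * (c - b)" using G1 ab by simp
  obtain e where e: "on (G a b c) e" "fcost (G a b c) a = \<bar>e - a\<bar>" using fcost_attained by blast
  have "\<bar>e - a\<bar> \<le> \<Gamma> * (c - b)" using nice3_bound[OF G, of a a b c "\<bar>b - c\<bar>"] e ab by simp
  then have "e \<le> a + \<Gamma> * (c - b)" by linarith
  then have ee: "e < 2 * b - c" using sep cc ab by linarith
  obtain s where s: "on (G a b c) s" "fcost (G a b c) b = \<bar>s - b\<bar>" using fcost_attained by blast
  have sb: "\<bar>s - b\<bar> \<le> c - b"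
    using sp1_cost[OF nice3_sp(2)[OF G, of a c] nice3_merge(2)[OF G, of a c], of b] s ab by simp
  obtain t where t: "on (G a b c) t" "fcost (G a b c) c = \<bar>t - c\<bar>" using fcost_attained by blast
  have tc: "\<bar>t - c\<bar> \<le> c - b"
    using sp1_cost[OF nice3_sp(3)[OF G] nice3_merge(2)[OF G], of a b c] t ab by simp
  have "e \<noteq> s" "e \<noteq> t" using ee sb tc ab by (auto simp: abs_le_iff)
  then have "t = s" using on_two[OF e(1) s(1) _ t(1)] by auto
  then show thesis using that[OF e(1) s(1) ee] sb tc by (simp add: abs_le_iff)
qed

section \<open>Holes in option sets and their propagation\<close>

text \<open>If the hole ended too early at some \<open>v\<close>, a third agent in its right half
  would be served at \<open>v\<close>, to the right of both \<open>b\<close> and itself, against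
  \<open>nice3_separated\<close>.\<close>

lemma shield_hole:
  assumes G: "nice3 \<Gamma> G" and sh: "shield G a b" and y: "b < y" "4 * \<Gamma> * (y - b) \<le> b - a"
  shows "\<not> on (G a b y) y"
proof
  assume on_y: "on (G a b y) y"
  obtain e where ab: "a < b" and e: "b < e" "\<And>y. b < y \<Longrightarrow> y < e \<Longrightarrow> \<not> on (G a b y) y"
    using sh by (auto simp: shield_def)
  \<comment> \<open>A point of the known hole left of the option \<open>y\<close>, from which the
    maximal hole is recovered.\<close>
  define t where "t = (b + min e y) / 2"
  have t: "b < t" "t < e" "t < y" using e y by (auto simp: t_def min_def field_simps)
  obtain g v where gv: "b \<le> g" "g < t" "t < v" "v \<le> y" "on (G a b g) g" "on (G a b v) v"
    "\<And>y. g < y \<Longrightarrow> y < v \<Longrightarrow> \<not> on (G a b y) y"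
    using sp1_hole[OF nice3_sp(3)[OF G] nice3_merge(2)[OF G] on_y t(1,3) e(2)[OF t(1,2)]] by blast
  have "g = b" using e(2)[of g] gv t by force
  define c where "c = (b + 3 * v) / 4"
  have c: "b < c" "c < v" "(g + v) / 2 < c" using gv t \<open>g = b\<close> by (auto simp: c_def)
  have v: "on (G a b c) v"
    using sp1_right[OF nice3_sp(3)[OF G] gv(6) _ gv(7) c(3)] gv c by auto
  have "4 * \<Gamma> * (c - b) \<le> 4 * \<Gamma> * (y - b)"
    using nice3_ge1[OF G] c gv by (intro mult_left_mono) auto
  then have "4 * \<Gamma> * (c - b) \<le> b - a" using y by linarith
  then obtain e s where "on (G a b c) e" "on (G a b c) s" "e < 2 * b - c" "b \<le> s" "s \<le> c"
    using nice3_separated[OF G ab c(1)] by blast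
  then show False using on_two[of "G a b c" e s v] v c by auto
qed

text \<open>With the third agent at \<open>c\<close> inside the hole, \<open>b\<close> is an option
  of the second agent. A gap in that agent's options between \<open>b\<close> and \<open>c\<close>
  would serve its left half from behind, against \<open>nice3_separated\<close>; so
  \<open>b'\<close> is an option too.\<close>

lemma shield_step:
  assumes G: "nice3 \<Gamma> G" and sh: "shield G a b" and b': "b < b'" "8 * \<Gamma> * (b' - b) < b - a"
  shows "shield G a b'"
proof -
  have G1: "1 \<le> \<Gamma>" using nice3_ge1[OF G] .
  have ab: "a < b" using sh by (simp add: shield_def)
  \<comment> \<open>The midpoint of the guaranteed hole: every facility within \<open>c - b\<close>
    of \<open>c\<close> other than \<open>b\<close> lies in that hole.\<close>
  define c where "c = b + (b - a) / (8 * \<Gamma>)"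
  have c8: "8 * \<Gamma> * (c - b) = b - a" using G1 by (simp add: c_def)
  have bc: "b' < c" using b' G1 by (simp add: c_def field_simps)
  have b_on: "on (G a b c) b"
  proof -
    obtain l where l: "on (G a b c) l" "fcost (G a b c) c = \<bar>l - c\<bar>" using fcost_attained by blast
    have lc: "\<bar>l - c\<bar> \<le> c - b"
      using sp1_cost[OF nice3_sp(3)[OF G] nice3_merge(2)[OF G], of a b c] l bc b' by simp
    have "l = b"
    proof (rule ccontr)
      assume "l \<noteq> b"
      then have l': "b < l" "l - b \<le> 2 * (c - b)" using lc by (auto simp: abs_le_iff)
      have "4 * \<Gamma> * (l - b) \<le> 4 * \<Gamma> * (2 * (c - b))" using l' G1 by (intro mult_left_mono) auto
      then show False
        using shield_hole[OF G sh l'(1)] sp1_on[OF nice3_sp(3)[OF G] l(1)] c8 by linarith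
    qed
    then show ?thesis using l by simp
  qed
  have sep: "4 * \<Gamma> * (c - t) \<le> t - a" if "b \<le> t" "t < c" for t
  proof -
    have "4 * \<Gamma> * (c - t) \<le> 8 * \<Gamma> * (c - b)" using G1 that by (intro mult_mono) auto
    then show ?thesis using c8 that by linarith
  qed
  have b'_on: "on (G a b' c) b'"
  proof (rule ccontr)
    assume not_on: "\<not> on (G a b' c) b'"
    obtain p q where pq: "b \<le> p" "p < b'" "b' < q" "q \<le> c" "on (G a p c) p" "on (G a q c) q"
      "\<And>y. p < y \<Longrightarrow> y < q \<Longrightarrow> \<not> on (G a y c) y"
      using sp1_hole[OF nice3_sp(2)[OF G] b_on nice3_merge(2)[OF G] b'(1) bc not_on] by blast
    define t where "t = (3 * p + q) / 4"
    have t: "p < t" "t < (p + q) / 2" using pq by (auto simp: t_def)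
    have p: "on (G a t c) p"
      using sp1_left[OF nice3_sp(2)[OF G] pq(5) _ pq(7) t(2)] pq t by simp
    have tt: "a < t" "b \<le> t" "t < c" using t pq(1-4) ab by auto
    obtain e s where "on (G a t c) e" "on (G a t c) s" "e < 2 * t - c" "t \<le> s" "s \<le> c"
      using nice3_separated[OF G tt(1,3) sep[OF tt(2,3)]] by blast
    then show False using on_two[of "G a t c" e s p] p t pq by auto
  qed
  have "a < b'" "b \<le> b'" using ab b' by auto
  then obtain e s where es: "on (G a b' c) e" "on (G a b' c) s" "e < 2 * b' - c" "b' \<le> s" "s \<le> c"
    using nice3_separated[OF G _ bc sep[OF _ bc]] by blast
  \<comment> \<open>The facilities are \<open>b'\<close> and the remote \<open>e\<close>, so the
    third agent at \<open>c\<close> pays at least \<open>c - b'\<close>; this yields the hole from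
    \<open>b'\<close> to \<open>c\<close>.\<close>
  have far: "c - b' \<le> \<bar>l - c\<bar>" if "on (G a b' c) l" for l
    using on_two[OF es(1) b'_on _ that] es bc by auto
  have "\<not> on (G a b' y) y" if "b' < y" "y < c" for y
  proof
    assume "on (G a b' y) y"
    then have "fcost (G a b' c) c \<le> c - y"
      using sp1_cost[OF nice3_sp(3)[OF G], of a b' y c] that by simp
    then show False using fcost_attained[of "G a b' c" c] far that by force
  qed
  then show ?thesis unfolding shield_def using bc ab b' by (intro conjI exI[of _ c]) auto
qed

text \<open>Steps of fixed length suffice, since the distance to \<open>a\<close>, and with it the
  admissible step, only grows.\<close>

lemma shield_mono:
  assumes G: "nice3 \<Gamma> G" and sh: "shield G a b" and "b \<le> b'"
  shows "shield G a b'"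
proof -
  have G1: "1 \<le> \<Gamma>" using nice3_ge1[OF G] .
  have ab: "a < b" using sh by (simp add: shield_def)
  define d where "d = (b - a) / (16 * \<Gamma>)"
  have d: "0 < d" "16 * \<Gamma> * d = b - a" using G1 ab by (auto simp: d_def)
  have steps: "shield G a t" if "b \<le> t" "t \<le> b + real n * d" for n t
    using that
  proof (induction n arbitrary: t)
    case 0
    then show ?case using sh by simp
  next
    case (Suc n)
    show ?case
    proof (cases "t \<le> b + real n * d")
      case True
      then show ?thesis using Suc by blast
    next
      case False
      have nd: "0 \<le> real n * d" using d by simp
      have "8 * \<Gamma> * (t - (b + real n * d)) \<le> 8 * \<Gamma> * d"
        using Suc.prems G1 by (intro mult_left_mono) (auto simp: algebra_simps)
      then have "8 * \<Gamma> * (t - (b + real n * d)) < b + real n * d - a" using d nd ab by linarith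
      then show ?thesis
        using shield_step[OF G Suc.IH[of "b + real n * d"]] False nd by simp
    qed
  qed
  obtain n where "b' - b < real n * d"
    using d(1) ex_less_of_nat_mult by blast
  then show ?thesis using steps[of b' n] \<open>b \<le> b'\<close> by simp
qed

text \<open>If \<open>b\<close> lay in a hole of the second agent, that agent could stand just left
  of its right end \<open>v\<close> and be served at \<open>v\<close>; the third agent moving to
  \<open>v\<close> would contradict \<open>shield_hole\<close>.\<close>

lemma shield_on:
  assumes G: "nice3 \<Gamma> G" and sh: "shield G a b" and "b \<le> c"
  shows "on (G a b c) b"
proof (rule ccontr)
  assume not_on: "\<not> on (G a b c) b"
  have G1: "1 \<le> \<Gamma>" using nice3_ge1[OF G] .
  have ab: "a < b" using sh by (simp add: shield_def)
  have bc: "b < c" using not_on \<open>b \<le> c\<close> nice3_merge(2)[OF G, of a b] by (cases "b = c") auto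
  obtain g v where gv: "a \<le> g" "g < b" "b < v" "v \<le> c" "on (G a g c) g" "on (G a v c) v"
      "\<And>y. g < y \<Longrightarrow> y < v \<Longrightarrow> \<not> on (G a y c) y"
    using sp1_hole[OF nice3_sp(2)[OF G] nice3_merge(4)[OF G] nice3_merge(2)[OF G] ab bc not_on] by blast
  define d where "d = (b - a) / (4 * \<Gamma>)"
  have d: "0 < d" "4 * \<Gamma> * d = b - a" using ab G1 by (auto simp: d_def)
  \<comment> \<open>Not left of \<open>b\<close>, hence still shielded; in the right half of the
    hole; and within the guaranteed hole length \<open>d\<close> of \<open>v\<close>.\<close>
  define t where "t = max (max b ((g + 3 * v) / 4)) (v - d)"
  have t: "b \<le> t" "t < v" "(g + v) / 2 < t" "v - d \<le> t"
    using gv d(1) unfolding t_def by (simp_all add: max_def)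
  have "on (G a t c) v"
    using sp1_right[OF nice3_sp(2)[OF G] gv(6) _ gv(7) t(3)] gv t by auto
  then have v: "on (G a t v) v" using sp1_on[OF nice3_sp(3)[OF G]] by blast
  have "4 * \<Gamma> * (v - t) \<le> 4 * \<Gamma> * d" using t(4) G1 by (intro mult_left_mono) auto
  then have "4 * \<Gamma> * (v - t) \<le> b - a" using d by simp
  then show False using shield_hole[OF G shield_mono[OF G sh t(1)] t(2)] t v by simp
qed

text \<open>A remote \<open>c\<close> draws the other facility away, so the first agent at
  \<open>a\<close> pays \<open>b - a\<close>, which makes a hole to the left of
  \<open>b\<close>.\<close>

lemma shield_reflect:
  assumes G: "nice3 \<Gamma> G" and sh: "shield G a b" and bc: "4 * \<Gamma> * (b - a) \<le> c - b"
  shows "shield (refl3 G) (- c) (- b)"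
proof -
  have G1: "1 \<le> \<Gamma>" using nice3_ge1[OF G] .
  have ab: "a < b" using sh by (simp add: shield_def)
  have "0 < 4 * \<Gamma> * (b - a)" using ab G1 by simp
  then have c: "b < c" using bc by linarith
  obtain e s where es: "on (refl3 G (-c) (-b) (-a)) e" "on (refl3 G (-c) (-b) (-a)) s"
    "e < 2 * - b - - a" "- b \<le> s" "s \<le> - a"
    using nice3_separated[OF nice3_refl[OF G], of "-c" "-b" "-a"] ab c bc by auto
  have b_on: "on (refl3 G (-c) (-b) (-a)) (-b)"
    using shield_on[OF G sh] c by (simp add: refl3_def)
  have far: "b - a \<le> \<bar>l - - a\<bar>" if "on (refl3 G (-c) (-b) (-a)) l" for l
    using on_two[OF es(1) b_on _ that] es ab by auto
  have "\<not> on (refl3 G (-c) (-b) y) y" if "- b < y" "y < - a" for y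
  proof
    assume "on (refl3 G (-c) (-b) y) y"
    then have "fcost (refl3 G (-c) (-b) (-a)) (-a) \<le> - a - y"
      using sp1_cost[OF nice3_sp(3)[OF nice3_refl[OF G]], of "-c" "-b" y "-a"] that by simp
    then show False using fcost_attained[of "refl3 G (-c) (-b) (-a)" "-a"] far that by force
  qed
  then show ?thesis unfolding shield_def using ab c by (intro conjI exI[of _ "- a"]) auto
qed

section \<open>From one served middle position to all\<close>

text \<open>With a facility at \<open>b\<close>, either \<open>c\<close> pays the full distance to
  \<open>b\<close>, or the other facility is right of \<open>b\<close> and \<open>a\<close> does.
  Either way there is a hole on one side.\<close>

lemma middle_shield:
  assumes G: "nice3 \<Gamma> G" and "middle G"
  obtains b c where "shield (refl3 G) (- c) (- b)"
proof -
  obtain a b c where abc: "a < b" "b < c" and b: "on (G a b c) b"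
    using assms(2) by (auto simp: middle_def)
  show thesis
  proof (cases "fcost (G a b c) c = c - b")
    case True
    have "\<not> on (G a b y) y" if "b < y" "y < c" for y
      using sp1_cost[OF nice3_sp(3)[OF G], of a b y c] True that by auto
    then have "shield G a b" unfolding shield_def using abc by (intro conjI exI[of _ c]) auto
    then show thesis using that[OF shield_reflect[OF G, of a b "b + 4 * \<Gamma> * (b - a)"]] by simp
  next
    case False
    obtain l where l: "on (G a b c) l" "fcost (G a b c) c = \<bar>l - c\<bar>" using fcost_attained by blast
    have "\<bar>l - c\<bar> < c - b" using False l fcost_le[OF b, of c] abc by simp
    then have "b < l" by linarith
    have cost: "fcost (G a b c) a = b - a"
      using fcost_attained[of "G a b c" a] on_two[OF b l(1)] fcost_le[OF b, of a] \<open>b < l\<close> abc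
      by fastforce
    have "\<not> on (refl3 G (-c) (-b) y) y" if "- b < y" "y < - a" for y
    proof
      assume "on (refl3 G (-c) (-b) y) y"
      then have "on (G (-y) b c) (-y)" by (simp add: refl3_def)
      then show False using sp1_cost[OF nice3_sp(1)[OF G], of "-y" b c a] cost that by auto
    qed
    then have "shield (refl3 G) (-c) (-b)"
      unfolding shield_def using abc by (intro conjI exI[of _ "-a"]) auto
    then show thesis by (rule that)
  qed
qed

lemma middle_far_left:
  assumes G: "nice3 \<Gamma> G" and "middle G"
  shows "\<exists>A. \<forall>a\<le>A. shield G a b"
proof -
  obtain b0 c where q0: "shield (refl3 G) (- c) (- b0)" using middle_shield[OF assms] .
  \<comment> \<open>In the mirror image the shield slides only to the left, afterwards only to the
    right, so the turning point must be right of neither \<open>b0\<close> nor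
    \<open>b\<close>.\<close>
  define b1 where "b1 = min b b0"
  have q: "shield (refl3 G) (- c) (- b1)"
    using shield_mono[OF nice3_refl[OF G] q0] by (simp add: b1_def)
  have "shield G a b" if "a \<le> b1 - 4 * \<Gamma> * (c - b1)" for a
    using shield_mono[OF G, of a b1 b] shield_reflect[OF nice3_refl[OF G] q, of "- a"] that
    by (simp add: b1_def)
  then show ?thesis by blast
qed

lemma middle_far_right_on:
  assumes G: "nice3 \<Gamma> G" and "middle G"
  shows "\<exists>C. \<forall>c\<ge>C. \<forall>a\<le>b. on (G a b c) b"
proof -
  obtain A where A: "\<And>a. a \<le> A \<Longrightarrow> shield (refl3 G) a (- b)"
    using middle_far_left[OF nice3_refl[OF G]] assms(2) middle_refl by blast
  have "on (G a b c) b" if "c \<ge> - A" "a \<le> b" for a c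
    using shield_on[OF nice3_refl[OF G] A[of "- c"], of "- a"] that by (simp add: refl3_def)
  then show ?thesis by blast
qed

text \<open>The second agent may move onto its facility \<open>s\<close>; if \<open>s < c\<close>,
  this would witness \<open>middle G\<close>.\<close>

lemma not_middle_right:
  assumes G: "nice3 \<Gamma> G" and "\<not> middle G" and abc: "a < b" "b < c" "4 * \<Gamma> * (c - b) \<le> b - a"
  shows "on (G a b c) c"
proof -
  obtain e s where s: "on (G a b c) s" "b \<le> s" "s \<le> c"
    using nice3_separated[OF G abc] by blast
  have "on (G a s c) s" using sp1_on[OF nice3_sp(2)[OF G] s(1)] .
  then have "\<not> s < c" using assms(2) s(2) abc(1) unfolding middle_def by (meson less_le_trans)
  then have "s = c" using s(3) by simp
  then show ?thesis using s by simp
qed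

lemma not_middle_left:
  assumes G: "nice3 \<Gamma> G" and "\<not> middle G" and abc: "a < b" "b < c" "4 * \<Gamma> * (b - a) \<le> c - b"
  shows "on (G a b c) a"
proof -
  have "on (refl3 G (- c) (- b) (- a)) (- a)"
    by (rule not_middle_right[OF nice3_refl[OF G]]) (use assms middle_refl in auto)
  then show ?thesis by (simp add: refl3_def)
qed

text \<open>In the hole \<open>(b, q)\<close> created by the second agent at \<open>b\<close>, put the third agent at a point
  \<open>t\<close> of the right half. The facility at \<open>q\<close> then shows that the hole which the third agent at \<open>t\<close>
  creates for the second one is at most half as long, although hole lengths are bounded below.\<close>

lemma shield_halving:
  assumes G: "nice3 \<Gamma> G" and a: "\<And>b. b0 \<le> b \<Longrightarrow> shield G a b" "\<And>b. b0 \<le> b \<Longrightarrow> shield (swap3 G) a b"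
    and b: "b0 \<le> b" "b < y" "4 * \<Gamma> * (y - b) \<le> 2 ^ n * (b0 - a)"
  shows "\<not> on (G a b y) y"
  using assms
\<comment> \<open>\<open>G\<close> is generalised because each step passes to
  \<open>swap3 G\<close>.\<close>
proof (induction n arbitrary: G b y)
  case 0
  then show ?case using shield_hole[OF 0(1) 0(2), of b y] by auto
next
  case (Suc n)
  have G: "nice3 \<Gamma> G" and sw: "nice3 \<Gamma> (swap3 G)" using Suc.prems nice3_swap by auto
  show ?case
  proof
    assume on_y: "on (G a b y) y"
    obtain e where ab: "a < b" and e: "b < e" "\<And>y. b < y \<Longrightarrow> y < e \<Longrightarrow> \<not> on (G a b y) y"
      using Suc.prems(2)[of b] Suc.prems(4) by (auto simp: shield_def)
    define m where "m = (b + min e y) / 2"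
    have m: "b < m" "m < e" "m < y" using e Suc.prems by (auto simp: m_def min_def field_simps)
    obtain g q where gq: "b \<le> g" "g < m" "m < q" "q \<le> y" "on (G a b g) g" "on (G a b q) q"
      "\<And>y. g < y \<Longrightarrow> y < q \<Longrightarrow> \<not> on (G a b y) y"
      using sp1_hole[OF nice3_sp(3)[OF G] nice3_merge(2)[OF G] on_y m(1,3) e(2)[OF m(1,2)]] by blast
    have "g = b" using e(2)[of g] gq m by force
    define t where "t = (b + 3 * q) / 4"
    have t: "b < t" "t < q" "(g + q) / 2 < t" using gq m \<open>g = b\<close> by (auto simp: t_def)
    have "on (G a b t) q"
      using sp1_right[OF nice3_sp(3)[OF G] gq(6) _ gq(7) t(3)] gq t by auto
    then have on_q: "on (swap3 G a t q) q"
      using sp1_on[OF nice3_sp(2)[OF G]] unfolding swap3_def by blast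
    have "4 * \<Gamma> * (q - t) \<le> 4 * \<Gamma> * ((y - b) / 2)"
      using nice3_ge1[OF G] gq t \<open>g = b\<close> by (intro mult_left_mono) auto
    moreover have "4 * \<Gamma> * ((y - b) / 2) = 4 * \<Gamma> * (y - b) / 2" by simp
    moreover have "4 * \<Gamma> * (y - b) \<le> 2 * (2 ^ n * (b0 - a))" using Suc.prems(6) by simp
    ultimately have "4 * \<Gamma> * (q - t) \<le> 2 ^ n * (b0 - a)" by linarith
    then show False
      using Suc.IH[OF sw, of t q] Suc.prems t on_q by auto
  qed
qed

text \<open>The approximation bound forces an option to the right of \<open>0\<close>, which
  \<open>shield_halving\<close> excludes for large \<open>n\<close>.\<close>

lemma middle_swap_right:
  assumes G: "nice3 \<Gamma> G" and mid: "middle G" "middle (swap3 G)"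
  shows False
proof -
  have sw: "nice3 \<Gamma> (swap3 G)" using G by (rule nice3_swap)
  obtain A B where "\<And>a. a \<le> A \<Longrightarrow> shield G a 0" "\<And>a. a \<le> B \<Longrightarrow> shield (swap3 G) a 0"
    using middle_far_left[OF G mid(1)] middle_far_left[OF sw mid(2)] by metis
  then obtain a where sh0: "shield G a 0" "shield (swap3 G) a 0"
    using min.cobounded1 min.cobounded2 by metis
  have sh: "shield G a b" "shield (swap3 G) a b" if "0 \<le> b" for b
    using shield_mono[OF G sh0(1) that] shield_mono[OF sw sh0(2) that] by auto
  have a: "a < 0" using sh0 by (simp add: shield_def)
  \<comment> \<open>So far right that a facility within \<open>\<Gamma> * (- a)\<close> of
    \<open>c\<close> is positive.\<close>
  define c where "c = \<Gamma> * (- a) + 1"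
  obtain l where l: "on (G a 0 c) l" "fcost (G a 0 c) c = \<bar>l - c\<bar>" using fcost_attained by blast
  have "\<bar>l - c\<bar> \<le> \<Gamma> * (- a)" using nice3_bound[OF G, of c a 0 c "\<bar>a - 0\<bar>"] l a by simp
  then have l0: "0 < l" by (simp add: c_def abs_le_iff)
  have on_l: "on (G a 0 l) l" using sp1_on[OF nice3_sp(3)[OF G] l(1)] .
  obtain n where "4 * \<Gamma> * l / (- a) < 2 ^ n" using real_arch_pow[of 2] by auto
  then have "4 * \<Gamma> * l \<le> 2 ^ n * (- a)" using a by (simp add: field_simps)
  then show False using shield_halving[OF G sh, of 0 0 l n] l0 on_l by auto
qed

section \<open>Many agents\<close>

text \<open>Since \<open>L\<close> ranges over all facility pairs, the last clause is an
  approximation ratio for the maximum cost. The congruence clause makes values at indices from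
  \<open>N\<close> on irrelevant.\<close>

definition niceN :: "nat \<Rightarrow> real \<Rightarrow> ((nat \<Rightarrow> real) \<Rightarrow> real \<times> real) \<Rightarrow> bool" where
  "niceN N \<Gamma> F \<longleftrightarrow> 1 \<le> \<Gamma> \<and> (\<forall>x y. (\<forall>i<N. x i = y i) \<longrightarrow> F x = F y)
     \<and> (\<forall>x y. \<forall>i<N. fcost (F x) (x i) \<le> fcost (F (x(i := y))) (x i))
     \<and> (\<forall>x L r. (\<forall>i<N. fcost L (x i) \<le> r) \<longrightarrow> (\<forall>i<N. fcost (F x) (x i) \<le> \<Gamma> * r))"

definition tri :: "nat set \<Rightarrow> nat set \<Rightarrow> real \<Rightarrow> real \<Rightarrow> real \<Rightarrow> nat \<Rightarrow> real" where
  "tri A B a b c = (\<lambda>i. if i \<in> A then a else if i \<in> B then b else c)"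

definition mech :: "((nat \<Rightarrow> real) \<Rightarrow> real \<times> real) \<Rightarrow> nat set \<Rightarrow> nat set \<Rightarrow> real \<Rightarrow> real \<Rightarrow> real \<Rightarrow> real \<times> real" where
  "mech F A B a b c = F (tri A B a b c)"

definition part :: "nat \<Rightarrow> nat set \<Rightarrow> nat set \<Rightarrow> nat set \<Rightarrow> bool" where
  "part N A B C \<longleftrightarrow> A \<union> B \<union> C = {..<N} \<and> A \<inter> B = {} \<and> A \<inter> C = {} \<and> B \<inter> C = {}
     \<and> A \<noteq> {} \<and> B \<noteq> {} \<and> C \<noteq> {}"

text \<open>This is decisiveness of \<open>B\<close> between the outer groups \<open>A\<close> and
  \<open>C\<close>.\<close>

definition dict :: "nat \<Rightarrow> ((nat \<Rightarrow> real) \<Rightarrow> real \<times> real) \<Rightarrow> nat set \<Rightarrow> nat set \<Rightarrow> nat set \<Rightarrow> bool" where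
  "dict N F A B C \<longleftrightarrow> part N A B C \<and> middle (mech F A B)"

definition reflN :: "((nat \<Rightarrow> real) \<Rightarrow> real \<times> real) \<Rightarrow> (nat \<Rightarrow> real) \<Rightarrow> real \<times> real" where
  "reflN F x = neg (F (\<lambda>i. - x i))"

lemma niceN_cong: "niceN N \<Gamma> F \<Longrightarrow> (\<And>i. i < N \<Longrightarrow> x i = y i) \<Longrightarrow> F x = F y"
  unfolding niceN_def by blast

lemma niceN_sp: "niceN N \<Gamma> F \<Longrightarrow> i < N \<Longrightarrow> fcost (F x) (x i) \<le> fcost (F (x(i := y))) (x i)"
  unfolding niceN_def by blast

lemma niceN_bound:
  "niceN N \<Gamma> F \<Longrightarrow> (\<And>j. j < N \<Longrightarrow> fcost L (x j) \<le> r) \<Longrightarrow> i < N \<Longrightarrow> fcost (F x) (x i) \<le> \<Gamma> * r"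
  unfolding niceN_def by blast

lemma niceN_ge1: "niceN N \<Gamma> F \<Longrightarrow> 1 \<le> \<Gamma>"
  by (simp add: niceN_def)

text \<open>The agents leave one by one; each is still at \<open>p\<close> when deviating, so the
  cost at \<open>p\<close> never falls.\<close>

lemma niceN_group:
  assumes F: "niceN N \<Gamma> F" and S: "S \<subseteq> {..<N}"
    and x: "\<And>i. i \<in> S \<Longrightarrow> x i = p" and y: "\<And>i. i < N \<Longrightarrow> i \<notin> S \<Longrightarrow> y i = x i"
  shows "fcost (F x) p \<le> fcost (F y) p"
proof -
  have "finite S" using S finite_subset by blast
  then show ?thesis
    using S x y
  proof (induction S arbitrary: x rule: finite_induct)
    case empty
    then show ?case using niceN_cong[OF F, of x y] by simp
  next
    case (insert i S)
    let ?z = "x(i := y i)"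
    have "fcost (F x) p \<le> fcost (F ?z) p"
      using niceN_sp[OF F, of i x "y i"] insert.prems(1,2) by simp
    also have "\<dots> \<le> fcost (F y) p"
      by (rule insert.IH) (use insert.prems insert.hyps in auto)
    finally show ?case .
  qed
qed

text \<open>Agents standing at \<open>l\<close> in \<open>y\<close> could return to their places in
  \<open>x\<close> and would then have a facility at \<open>l\<close>.\<close>

lemma niceN_move:
  assumes F: "niceN N \<Gamma> F" and S: "S \<subseteq> {..<N}" and x: "on (F x) l"
    and y: "\<And>i. i \<in> S \<Longrightarrow> y i = l" "\<And>i. i < N \<Longrightarrow> i \<notin> S \<Longrightarrow> y i = x i"
  shows "on (F y) l"
proof -
  have "fcost (F y) l \<le> fcost (F x) l"
    by (rule niceN_group[OF F S]) (use y in auto)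
  then show ?thesis using x by (metis fcost_eq_0 fcost_le_0)
qed

lemma niceN_refl:
  assumes F: "niceN N \<Gamma> F" shows "niceN N \<Gamma> (reflN F)"
  unfolding niceN_def
proof (intro conjI allI impI)
  show "1 \<le> \<Gamma>" using niceN_ge1[OF F] .
  fix x y :: "nat \<Rightarrow> real" assume "\<forall>i<N. x i = y i"
  then show "reflN F x = reflN F y"
    unfolding reflN_def by (intro arg_cong[of _ _ neg] niceN_cong[OF F]) simp
next
  fix x :: "nat \<Rightarrow> real" and y i assume i: "i < N"
  have "(\<lambda>j. - (x(i := y)) j) = (\<lambda>j. - x j)(i := - y)" by auto
  then show "fcost (reflN F x) (x i) \<le> fcost (reflN F (x(i := y))) (x i)"
    unfolding reflN_def fcost_neg using niceN_sp[OF F i, of "\<lambda>j. - x j" "- y"] by simp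
next
  fix x :: "nat \<Rightarrow> real" and L r i assume r: "\<forall>i<N. fcost L (x i) \<le> r" and i: "i < N"
  show "fcost (reflN F x) (x i) \<le> \<Gamma> * r"
    unfolding reflN_def fcost_neg
    by (rule niceN_bound[OF F, of "neg L" "\<lambda>j. - x j", OF _ i]) (use r in simp)
qed

lemma nice3_mech:
  assumes F: "niceN N \<Gamma> F" and P: "part N A B C"
  shows "nice3 \<Gamma> (mech F A B)"
  unfolding nice3_def
proof (intro conjI allI ballI)
  have sub: "A \<subseteq> {..<N}" "B \<subseteq> {..<N}" "C \<subseteq> {..<N}" using P by (auto simp: part_def)
  show "1 \<le> \<Gamma>" using niceN_ge1[OF F] .
  show "sp1 (\<lambda>a. mech F A B a b c)" for b c
    unfolding sp1_def mech_def
    by (intro allI niceN_group[OF F sub(1)]) (auto simp: tri_def)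
  show "sp1 (\<lambda>b. mech F A B a b c)" for a c
    unfolding sp1_def mech_def
    by (intro allI niceN_group[OF F sub(2)]) (use P in \<open>auto simp: tri_def part_def\<close>)
  show "sp1 (mech F A B a b)" for a b
    unfolding sp1_def mech_def
    by (intro allI niceN_group[OF F sub(3)]) (use P in \<open>auto simp: tri_def part_def\<close>)
  fix a b c y r :: real assume y: "y \<in> {a, b, c}" and r: "r \<in> {\<bar>a - b\<bar>, \<bar>a - c\<bar>, \<bar>b - c\<bar>}"
  obtain i1 i2 i3 where "i1 \<in> A" "i2 \<in> B" "i3 \<in> C" using P unfolding part_def by blast
  then have "i1 < N" "i2 < N" "i3 < N" "tri A B a b c i1 = a" "tri A B a b c i2 = b" "tri A B a b c i3 = c"
    using sub P unfolding part_def tri_def by auto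
  then obtain i where i: "i < N" "tri A B a b c i = y" using y by blast
  obtain L where L: "fcost L a \<le> r" "fcost L b \<le> r" "fcost L c \<le> r"
  proof -
    have "r = \<bar>a - b\<bar> \<or> r = \<bar>a - c\<bar> \<or> r = \<bar>b - c\<bar>" using r by simp
    then show thesis
    proof (elim disjE)
      assume "r = \<bar>a - b\<bar>" then show thesis using that[of "(a, c)"] by (auto simp: fcost_def)
    next
      assume "r = \<bar>a - c\<bar>" then show thesis using that[of "(a, b)"] by (auto simp: fcost_def)
    next
      assume "r = \<bar>b - c\<bar>" then show thesis using that[of "(b, a)"] by (auto simp: fcost_def)
    qed
  qed
  then have "fcost L (tri A B a b c j) \<le> r" for j by (auto simp: tri_def)
  then show "fcost (mech F A B a b c) y \<le> \<Gamma> * r"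
    using niceN_bound[OF F, of L "tri A B a b c" r i] i by (simp add: mech_def)
qed

section \<open>Calculus of decisive groups\<close>

lemma dict_part: "dict N F A B C \<Longrightarrow> part N A B C"
  by (simp add: dict_def)

lemma dict_nice3: "niceN N \<Gamma> F \<Longrightarrow> dict N F A B C \<Longrightarrow> nice3 \<Gamma> (mech F A B)"
  using nice3_mech dict_part by blast

lemma part_swap_left: "part N A B C \<Longrightarrow> part N B A C"
  by (auto simp: part_def)

lemma part_swap_right: "part N A B C \<Longrightarrow> part N A C B"
  by (auto simp: part_def)

lemma dictI:
  "part N A B C \<Longrightarrow> a < b \<Longrightarrow> b < c \<Longrightarrow> on (F (tri A B a b c)) b \<Longrightarrow> dict N F A B C"
  unfolding dict_def middle_def mech_def by blast

lemma dict_refl: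
  assumes F: "niceN N \<Gamma> F" shows "dict N (reflN F) C B A \<longleftrightarrow> dict N F A B C"
proof -
  have "part N C B A \<longleftrightarrow> part N A B C" by (auto simp: part_def)
  moreover have "middle (mech (reflN F) C B) \<longleftrightarrow> middle (mech F A B)" if P: "part N A B C"
  proof -
    have "F (\<lambda>i. - tri C B a b c i) = F (tri A B (- c) (- b) (- a))" for a b c
      by (rule niceN_cong[OF F]) (use P in \<open>auto simp: tri_def part_def\<close>)
    then have "mech (reflN F) C B = refl3 (mech F A B)"
      by (simp add: mech_def reflN_def refl3_def fun_eq_iff)
    then show ?thesis by (simp add: middle_refl)
  qed
  ultimately show ?thesis unfolding dict_def by blast
qed

text \<open>Exchanging the middle and the right group amounts to \<open>swap3\<close>.\<close>

lemma dict_unique_right: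
  assumes F: "niceN N \<Gamma> F" and D: "dict N F A B C" "dict N F A C B"
  shows False
proof -
  have "mech F A C = swap3 (mech F A B)"
  proof (intro ext)
    fix a b c
    show "mech F A C a b c = swap3 (mech F A B) a b c"
      unfolding mech_def swap3_def
      by (rule niceN_cong[OF F]) (use dict_part[OF D(1)] in \<open>auto simp: tri_def part_def\<close>)
  qed
  then show False
    using middle_swap_right[OF dict_nice3[OF F D(1)]] D by (simp add: dict_def)
qed

lemma dict_unique_left:
  assumes F: "niceN N \<Gamma> F" and D: "dict N F A B C" "dict N F B A C"
  shows False
  by (rule dict_unique_right[OF niceN_refl[OF F], of C B A]) (use D in \<open>simp_all only: dict_refl[OF F]\<close>)

lemma dict_absorb:
  assumes F: "niceN N \<Gamma> F" and D: "dict N F A B (C \<union> T)" and T: "C \<inter> T = {}" "C \<noteq> {}"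
  shows "dict N F A (B \<union> T) C"
proof -
  have P: "part N A B (C \<union> T)" using dict_part[OF D] .
  obtain a b c where abc: "a < b" "b < c" "on (F (tri A B a b c)) b"
    using D by (auto simp: dict_def middle_def mech_def)
  have "on (F (tri A (B \<union> T) a b c)) b"
    by (rule niceN_move[OF F, of T, OF _ abc(3)]) (use P T in \<open>auto simp: part_def tri_def\<close>)
  moreover have "part N A (B \<union> T) C" using P T unfolding part_def by blast
  ultimately show ?thesis using abc dictI by blast
qed

text \<open>With \<open>A\<close> far to the left, the agents of \<open>T\<close> at \<open>c\<close> pay \<open>c - b\<close>; if \<open>B\<close> were not
  decisive after the transfer, they could bring the facility to \<open>c\<close> by moving over to \<open>A\<close>.\<close>

lemma dict_transfer_left:
  assumes F: "niceN N \<Gamma> F" and D: "dict N F A B (C \<union> T)" and T: "C \<inter> T = {}" "C \<noteq> {}"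
  shows "dict N F (A \<union> T) B C"
proof (rule ccontr)
  assume nD: "\<not> dict N F (A \<union> T) B C"
  have P: "part N A B (C \<union> T)" using dict_part[OF D] .
  have P': "part N (A \<union> T) B C" using P T unfolding part_def by blast
  have G: "nice3 \<Gamma> (mech F A B)" using dict_nice3[OF F D] .
  have G': "nice3 \<Gamma> (mech F (A \<union> T) B)" using nice3_mech[OF F P'] .
  have \<Gamma>: "1 \<le> \<Gamma>" using niceN_ge1[OF F] .
  obtain a0 where "shield (mech F A B) a0 0"
    using middle_far_left[OF G] D unfolding dict_def by blast
  then have a: "a0 < 0" and b_on: "\<And>c. 0 \<le> c \<Longrightarrow> on (mech F A B a0 0 c) 0"
    using shield_on[OF G] by (auto simp: shield_def)
  \<comment> \<open>The largest \<open>c\<close> for which \<open>0\<close> and \<open>c\<close>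
    count as close compared with \<open>a0\<close>.\<close>
  define c where "c = - a0 / (4 * \<Gamma>)"
  have c: "0 < c" "4 * \<Gamma> * (c - 0) \<le> 0 - a0"
    using a \<Gamma> by (auto simp: c_def divide_neg_pos)
  obtain e s where es: "on (mech F A B a0 0 c) e" "on (mech F A B a0 0 c) s"
    "e < 2 * 0 - c" "0 \<le> s" "s \<le> c"
    using nice3_separated[OF G a c] by auto
  have "0 < fcost (mech F A B a0 0 c) c"
  proof -
    obtain l where l: "on (mech F A B a0 0 c) l" "fcost (mech F A B a0 0 c) c = \<bar>l - c\<bar>"
      using fcost_attained by blast
    have "l = e \<or> l = 0" using on_two[OF es(1) b_on _ l(1)] es(3) c(1) by auto
    then show ?thesis using l(2) es(3) c(1) by auto
  qed
  moreover have "on (mech F (A \<union> T) B a0 0 c) c"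
    using not_middle_right[OF G' _ a c] nD P' by (auto simp: dict_def)
  moreover have "fcost (F (tri A B a0 0 c)) c \<le> fcost (F (tri (A \<union> T) B a0 0 c)) c"
    by (rule niceN_group[OF F, of T]) (use P T in \<open>auto simp: part_def tri_def\<close>)
  ultimately show False by (simp add: mech_def flip: fcost_eq_0)
qed

lemma dict_transfer_right:
  assumes F: "niceN N \<Gamma> F" and D: "dict N F (A \<union> T) B C" and T: "A \<inter> T = {}" "A \<noteq> {}"
  shows "dict N F A B (C \<union> T)"
proof -
  have "dict N (reflN F) (C \<union> T) B A"
    by (rule dict_transfer_left[OF niceN_refl[OF F]]) (simp_all add: dict_refl[OF F] D T)
  then show ?thesis by (simp only: dict_refl[OF F])
qed

text \<open>With \<open>B\<close> far to the right, a single facility serves \<open>U\<close>, \<open>X\<close>, \<open>Y\<close> at \<open>0 < 1 < 2\<close>: decisiveness of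
  \<open>X \<union> Y\<close> keeps it from being left of \<open>1\<close>, the failure for \<open>Y\<close> alone keeps it from being right of \<open>1\<close>.
  Then \<open>B\<close> jumps onto it.\<close>

lemma dict_split_left:
  assumes F: "niceN N \<Gamma> F" and D: "dict N F U (X \<union> Y) B" and XY: "X \<inter> Y = {}" "X \<noteq> {}" "Y \<noteq> {}"
    and nD: "\<not> dict N F (U \<union> X) Y B"
  shows "dict N F U (X \<union> B) Y"
proof -
  have P: "part N U (X \<union> Y) B" using dict_part[OF D] .
  have P': "part N (U \<union> X) Y B" using P XY unfolding part_def by blast
  have G: "nice3 \<Gamma> (mech F U (X \<union> Y))" using dict_nice3[OF F D] .
  have G': "nice3 \<Gamma> (mech F (U \<union> X) Y)" using nice3_mech[OF F P'] .
  obtain C where C: "\<And>c. C \<le> c \<Longrightarrow> on (mech F U (X \<union> Y) 0 1 c) 1"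
    using middle_far_right_on[OF G, of 1] D unfolding dict_def by force
  have \<Gamma>: "1 \<le> \<Gamma>" using niceN_ge1[OF F] .
  \<comment> \<open>Beyond \<open>C\<close> there is a facility at \<open>1\<close> for
    \<open>X \<union> Y\<close>; the second bound admits \<open>not_middle_left\<close> and
    separates the facility near \<open>b\<close> from the one serving \<open>0\<close> and
    \<open>2\<close>.\<close>
  define b where "b = max C (2 + 4 * \<Gamma>)"
  have b: "C \<le> b" "2 + 4 * \<Gamma> \<le> b" by (auto simp: b_def)
  define x where "x = (\<lambda>i. if i \<in> U then 0 else if i \<in> X then 1 else if i \<in> Y then 2 else b)"
  have "fcost (F x) 2 \<le> fcost (F (tri U (X \<union> Y) 0 1 b)) 2"
    by (rule niceN_group[OF F, of Y]) (use P XY in \<open>auto simp: part_def tri_def x_def\<close>)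
  also have "\<dots> \<le> 1" using fcost_le[OF C[OF b(1)], of 2] by (simp add: mech_def)
  finally have Y: "fcost (F x) 2 \<le> 1" .
  have "on (mech F (U \<union> X) Y 1 2 b) 1"
    by (rule not_middle_left[OF G']) (use nD P' b \<Gamma> in \<open>auto simp: dict_def\<close>)
  then have "fcost (F (tri (U \<union> X) Y 1 2 b)) 0 \<le> 1" using fcost_le[of _ 1 0] by (simp add: mech_def)
  moreover have "fcost (F x) 0 \<le> fcost (F (tri (U \<union> X) Y 1 2 b)) 0"
    by (rule niceN_group[OF F, of U]) (use P XY in \<open>auto simp: part_def tri_def x_def\<close>)
  ultimately have U: "fcost (F x) 0 \<le> 1" by simp
  obtain k where k: "k \<in> B" using P by (auto simp: part_def)
  have "fcost (F x) (x k) \<le> \<Gamma> * 1"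
    by (rule niceN_bound[OF F, of "(1, b)"]) (use k P in \<open>auto simp: part_def x_def fcost_def\<close>)
  moreover have "x k = b" using k P by (auto simp: x_def part_def)
  ultimately have B: "fcost (F x) b \<le> \<Gamma>" by simp
  obtain e l m where e: "on (F x) e" "\<bar>e - b\<bar> \<le> \<Gamma>" and l: "on (F x) l" "\<bar>l - 2\<bar> \<le> 1"
    and m: "on (F x) m" "\<bar>m - 0\<bar> \<le> 1"
    using fcost_attained[of "F x" b] fcost_attained[of "F x" 2] fcost_attained[of "F x" 0] B Y U by metis
  have "e \<noteq> l" "e \<noteq> m" using e l m b \<Gamma> by (auto simp: abs_le_iff)
  then have "m = l" using on_two[OF e(1) l(1) _ m(1)] by auto
  \<comment> \<open>The common facility is within \<open>1\<close> of both \<open>0\<close> and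
    \<open>2\<close>.\<close>
  then have "on (F x) 1" using l m by (simp add: abs_le_iff)
  then have "on (F (tri U (X \<union> B) 0 1 2)) 1"
    by (rule niceN_move[OF F, of B, rotated]) (use P XY in \<open>auto simp: part_def tri_def x_def\<close>)
  moreover have "part N U (X \<union> B) Y" using P XY unfolding part_def by blast
  ultimately show ?thesis by (intro dictI[of _ _ _ _ 0 1 2]) auto
qed

text \<open>The mirror image of \<open>dict_split_left\<close>, with \<open>X\<close> and
  \<open>Y\<close> exchanged.\<close>

lemma dict_split_right:
  assumes F: "niceN N \<Gamma> F" and D: "dict N F U (X \<union> Y) B" and XY: "X \<inter> Y = {}" "X \<noteq> {}" "Y \<noteq> {}"
    and nD: "\<not> dict N F U X (B \<union> Y)"
  shows "dict N F X (Y \<union> U) B"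
proof -
  have "dict N (reflN F) B (Y \<union> U) X"
  proof (rule dict_split_left[OF niceN_refl[OF F]])
    show "dict N (reflN F) B (Y \<union> X) U" using D by (simp add: dict_refl[OF F] Un_commute)
    show "\<not> dict N (reflN F) (B \<union> Y) X U" using nD by (simp add: dict_refl[OF F])
  qed (use XY in auto)
  then show ?thesis by (simp add: dict_refl[OF F])
qed

section \<open>Redistribution of outer agents and minimal decisive sets\<close>

lemma card_less_obtain:
  assumes "card B < card A" "finite B"
  obtains w where "w \<in> A" "w \<notin> B"
  using card_mono[OF assms(2), of A] assms(1) by (meson not_le subsetI)

text \<open>First \<open>U - U'\<close> crosses to the right, then \<open>U' - U\<close> to the
  left; the common agents keep the left group nonempty.\<close>

lemma dict_redistribute_left:
  assumes F: "niceN N \<Gamma> F" and D: "dict N F U S B" and P': "part N U' S B'" and K: "U \<inter> U' \<noteq> {}"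
  shows "dict N F U' S B'"
proof -
  have P: "part N U S B" using dict_part[OF D] .
  have "dict N F ((U \<inter> U') \<union> (U - U')) S B" using D by (simp add: Int_Diff_Un)
  then have "dict N F (U \<inter> U') S (B \<union> (U - U'))"
    by (rule dict_transfer_right[OF F]) (use K in auto)
  moreover have "U \<subseteq> {..<N} - S" "B = {..<N} - S - U" using P unfolding part_def by blast+
  moreover have "U' \<subseteq> {..<N} - S" "B' = {..<N} - S - U'" using P' unfolding part_def by blast+
  moreover have "B \<union> (U - U') = B' \<union> (U' - U)" using calculation(2-5) by blast
  ultimately have "dict N F (U \<inter> U') S (B' \<union> (U' - U))" by simp
  then have "dict N F ((U \<inter> U') \<union> (U' - U)) S B'"
    by (rule dict_transfer_left[OF F]) (use P' in \<open>auto simp: part_def\<close>)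
  moreover have "(U \<inter> U') \<union> (U' - U) = U'" by blast
  ultimately show ?thesis by simp
qed

lemma dict_redistribute_right:
  assumes F: "niceN N \<Gamma> F" and D: "dict N F U S B" and P': "part N U' S B'" and K: "B \<inter> B' \<noteq> {}"
  shows "dict N F U' S B'"
proof -
  have "dict N (reflN F) B' S U'"
    by (rule dict_redistribute_left[OF niceN_refl[OF F] _ _ K])
      (use D P' in \<open>auto simp: dict_refl[OF F] part_def\<close>)
  then show ?thesis by (simp only: dict_refl[OF F])
qed

text \<open>Without a common agent on either side the outer groups are exactly exchanged. Of three
  outer agents two share a side, and sending one of them across first creates a common
  agent.\<close>

lemma dict_redistribute:
  assumes F: "niceN N \<Gamma> F" and D: "dict N F U S B" and P': "part N U' S B'" and card: "3 \<le> card (U \<union> B)"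
  shows "dict N F U' S B'"
proof (cases "U \<inter> U' = {} \<and> B \<inter> B' = {}")
  case False
  then show ?thesis using dict_redistribute_left[OF F D P'] dict_redistribute_right[OF F D P'] by blast
next
  case True
  have P: "part N U S B" using dict_part[OF D] .
  then have "finite (U \<union> B)" unfolding part_def by (metis finite_Un finite_lessThan)
  then have fin: "finite U" "finite B" by auto
  have "U \<subseteq> {..<N} - S" "B = {..<N} - S - U" using P unfolding part_def by blast+
  moreover have "U' \<subseteq> {..<N} - S" "B' = {..<N} - S - U'" using P' unfolding part_def by blast+
  ultimately have swap: "U' = B" "B' = U" using True by blast+
  have "card U + card B \<ge> 3" using card_Un_le[of U B] card by linarith
  then consider "2 \<le> card B" | "2 \<le> card U" by linarith
  then show ?thesis
  proof cases
    case 1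
    then obtain w where w: "w \<in> B" using card_less_obtain[of "{}" B] by force
    obtain v where "v \<in> B" "v \<notin> {w}" using 1 card_less_obtain[of "{w}" B] by force
    then have w: "w \<in> B" "B - {w} \<noteq> {}" using w by auto
    have eq: "(B - {w}) \<union> {w} = B" using w by blast
    have "dict N F U S ((B - {w}) \<union> {w})" by (simp only: eq D)
    then have "dict N F (U \<union> {w}) S (B - {w})"
      by (rule dict_transfer_left[OF F]) (use w in auto)
    then show ?thesis by (rule dict_redistribute_left[OF F _ P']) (use w swap in auto)
  next
    case 2
    then obtain w where w: "w \<in> U" using card_less_obtain[of "{}" U] by force
    obtain v where "v \<in> U" "v \<notin> {w}" using 2 card_less_obtain[of "{w}" U] by force
    then have w: "w \<in> U" "U - {w} \<noteq> {}" using w by auto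
    have eq: "(U - {w}) \<union> {w} = U" using w by blast
    have "dict N F ((U - {w}) \<union> {w}) S B" by (simp only: eq D)
    then have "dict N F (U - {w}) S (B \<union> {w})"
      by (rule dict_transfer_right[OF F]) (use w in auto)
    then show ?thesis by (rule dict_redistribute_right[OF F _ P']) (use w swap in auto)
  qed
qed

text \<open>Splitting a minimal decisive set from both sides produces two decisive sets that exclude
  each other, provided a further agent \<open>w\<close> is left to be placed on the far left.\<close>

lemma dict_minimal_singleton:
  assumes F: "niceN N \<Gamma> F" and N: "5 \<le> N" and D: "dict N F U S B"
    and min: "\<And>U' S' B'. dict N F U' S' B' \<Longrightarrow> card S \<le> card S'"
  shows "card S = 1"
proof (rule ccontr)
  assume S1: "card S \<noteq> 1"
  have P: "part N U S B" using dict_part[OF D] .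
  then have "finite (U \<union> S \<union> B)" by (simp add: part_def)
  then have fin: "finite S" "finite (U \<union> B)" by auto
  have S0: "card S \<noteq> 0" using P fin by (auto simp: part_def)
  have less: "\<not> dict N F U' S' B'" if "S' \<subset> S" for U' S' B'
    using min psubset_card_mono[OF fin(1) that] by (meson not_le)
  show False
  proof (cases "3 \<le> card S")
    case True
    \<comment> \<open>Here the extra agent \<open>w\<close> can be taken from \<open>S\<close>
      itself.\<close>
    obtain x where x: "x \<in> S" using S0 by fastforce
    obtain y where y: "y \<in> S" "y \<noteq> x" using card_less_obtain[of "{x}" S] True by force
    obtain w where w: "w \<in> S" "w \<noteq> x" "w \<noteq> y"
      using card_less_obtain[of "{x, y}" S] True y by force
    have less': "\<not> dict N F U' (S - {x}) B'" "\<not> dict N F U' (S - {y}) B'" for U' B'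
      by (rule less, use x y in blast)+
    have "{x} \<union> (S - {x}) = S" using x by blast
    then have "dict N F U ({x} \<union> (S - {x})) B" using D by simp
    then have "dict N F U ({x} \<union> B) (S - {x})"
      by (rule dict_split_left[OF F]) (use x y less' in auto)
    moreover have "S - {x} = (S - {x, w}) \<union> {w}" using w by blast
    ultimately have "dict N F U ({x} \<union> B) ((S - {x, w}) \<union> {w})" by simp
    then have "dict N F (U \<union> {w}) ({x} \<union> B) (S - {x, w})"
      by (rule dict_transfer_left[OF F]) (use y w in auto)
    then have "dict N F ({w} \<union> U) ({x} \<union> B) (S - {x, w})" by simp
    then have "dict N F {w} ({x} \<union> B) ((S - {x, w}) \<union> U)"
      by (rule dict_transfer_right[OF F]) (use P w in \<open>auto simp: part_def\<close>)
    \<comment> \<open>Regrouping lets the middle absorb \<open>S - {x, y, w}\<close>, so that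
      exactly the group \<open>{y} \<union> U\<close> of the second split remains on the
      right.\<close>
    moreover have "(S - {x, w}) \<union> U = ({y} \<union> U) \<union> (S - {x, y, w})" using y w by blast
    ultimately have "dict N F {w} ({x} \<union> B) (({y} \<union> U) \<union> (S - {x, y, w}))" by simp
    then have 1: "dict N F {w} (({x} \<union> B) \<union> (S - {x, y, w})) ({y} \<union> U)"
      by (rule dict_absorb[OF F]) (use P in \<open>auto simp: part_def\<close>)
    have "(S - {y}) \<union> {y} = S" using y by blast
    then have "dict N F U ((S - {y}) \<union> {y}) B" using D by simp
    then have "dict N F (S - {y}) ({y} \<union> U) B"
      by (rule dict_split_right[OF F]) (use x y less' in auto)
    moreover have "S - {y} = {w} \<union> (S - {y, w})" using w by blast
    ultimately have "dict N F ({w} \<union> (S - {y, w})) ({y} \<union> U) B" by simp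
    then have "dict N F {w} ({y} \<union> U) (B \<union> (S - {y, w}))"
      by (rule dict_transfer_right[OF F]) auto
    moreover have "B \<union> (S - {y, w}) = ({x} \<union> B) \<union> (S - {x, y, w})" using x y w by blast
    ultimately show False using dict_unique_right[OF F 1] by simp
  next
    case False
    then have "card S = 2" using S0 S1 by linarith
    then obtain x y where S: "S = {x, y}" "x \<noteq> y" by (meson card_2_iff)
    define R where "R = U \<union> B"
    have "card (R \<union> S) = N" using P by (simp add: part_def R_def Un_ac)
    \<comment> \<open>Five agents leave three outside \<open>S\<close>: enough for \<open>w\<close>,
      \<open>u\<close> and a nonempty \<open>B'\<close>.\<close>
    then have R3: "3 \<le> card R" using card_Un_le[of R S] \<open>card S = 2\<close> N by linarith
    obtain w where w: "w \<in> R" using R3 by fastforce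
    obtain u where u: "u \<in> R" "u \<noteq> w" using card_less_obtain[of "{w}" R] R3 by force
    obtain v where v: "v \<in> R" "v \<noteq> w" "v \<noteq> u"
      using card_less_obtain[of "{w, u}" R] R3 u by force
    define B' where "B' = R - {w, u}"
    have B': "B' \<noteq> {}" "w \<notin> B'" "u \<notin> B'" "R = {w, u} \<union> B'" using w u v by (auto simp: B'_def)
    have PR: "R \<union> {x, y} = {..<N}" "R \<inter> {x, y} = {}" using P S by (auto simp: part_def R_def)
    have parts: "part N ({w} \<union> {u}) ({x} \<union> {y}) B'" "part N {u} ({x} \<union> {y}) (B' \<union> {w})"
      using PR B' u unfolding part_def by auto
    have "{x} \<subset> S" "{y} \<subset> S" using S by auto
    note less' = less[OF this(1)] less[OF this(2)]
    have D': "dict N F U ({x} \<union> {y}) B" using D S by (simp add: insert_commute)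
    have "dict N F ({w} \<union> {u}) ({x} \<union> {y}) B'"
      by (rule dict_redistribute[OF F D' parts(1)]) (use R3 in \<open>simp add: R_def\<close>)
    then have "dict N F ({w} \<union> {u}) ({x} \<union> B') {y}"
      by (rule dict_split_left[OF F]) (use S less' in auto)
    then have 1: "dict N F {w} ({x} \<union> B') ({y} \<union> {u})"
      by (rule dict_transfer_right[OF F]) (use u in auto)
    have "dict N F {u} ({x} \<union> {y}) (B' \<union> {w})"
      by (rule dict_redistribute[OF F D' parts(2)]) (use R3 in \<open>simp add: R_def\<close>)
    then have "dict N F {x} ({y} \<union> {u}) (B' \<union> {w})"
      by (rule dict_split_right[OF F]) (use S less' in auto)
    then have "dict N F ({x} \<union> {w}) ({y} \<union> {u}) B'"
      by (rule dict_transfer_left[OF F]) (use B' in auto)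
    then have "dict N F ({w} \<union> {x}) ({y} \<union> {u}) B'" by (simp add: insert_commute)
    then have "dict N F {w} ({y} \<union> {u}) (B' \<union> {x})"
      by (rule dict_transfer_right[OF F]) (use PR w in auto)
    then show False using dict_unique_right[OF F 1] by simp
  qed
qed

text \<open>A least decisive set is some \<open>{d}\<close>; enough outer agents remain for
  \<open>dict_redistribute\<close> to reach every partition around \<open>d\<close>.\<close>

lemma dict_singleton:
  assumes F: "niceN N \<Gamma> F" and N: "5 \<le> N" and D: "dict N F U S B"
  obtains d where "d < N" "\<And>U' B'. part N U' {d} B' \<Longrightarrow> dict N F U' {d} B'"
proof -
  define Q where "Q = (\<lambda>S. \<exists>U B. dict N F U S B)"
  have "Q S" using D by (auto simp: Q_def)
  then obtain T where T: "Q T" "\<And>S'. Q S' \<Longrightarrow> card T \<le> card S'"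
    using ex_has_least_nat[of Q S card] by blast
  obtain U' B' where DT: "dict N F U' T B'" using T by (auto simp: Q_def)
  have "card T = 1"
    by (rule dict_minimal_singleton[OF F N DT]) (use T in \<open>auto simp: Q_def\<close>)
  then obtain d where d: "T = {d}" using card_1_singletonE by blast
  have P: "part N U' {d} B'" using dict_part[OF DT] d by simp
  then have "U' \<union> B' = {..<N} - {d}" "d < N" unfolding part_def by auto
  then have "3 \<le> card (U' \<union> B')" using N by simp
  then show thesis using that \<open>d < N\<close> dict_redistribute[OF F] DT d by blast
qed

section \<open>Excluding two distinct interior facilities\<close>

lemma dict_collapse:
  assumes F: "niceN N \<Gamma> F" and N: "3 \<le> N" and l: "on (F x) l"
    and pq: "p < N" "q < N" "x p < l" "l < x q"
  shows "dict N F {p} ({..<N} - {p, q}) {q}"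
proof (rule dictI)
  have "card {p, q} < card {..<N}" using N by (simp add: card_insert_if)
  then obtain w where "w < N" "w \<notin> {p, q}" using card_less_obtain[of "{p, q}" "{..<N}"] by auto
  then show "part N {p} ({..<N} - {p, q}) {q}" using pq unfolding part_def by auto
  show "on (F (tri {p} ({..<N} - {p, q}) (x p) l (x q))) l"
    by (rule niceN_move[OF F, of "{..<N} - {p, q}", OF _ l]) (use pq in \<open>auto simp: tri_def\<close>)
qed (use pq in auto)

lemma no_interior_pair:
  assumes F: "niceN N \<Gamma> F" and N: "5 \<le> N" and l: "on (F x) l1" "on (F x) l2" "l1 < l2"
    and ab: "a < N" "b < N" "x a < l1" "l2 < x b"
  shows False
proof -
  have "dict N F {a} ({..<N} - {a, b}) {b}"
    by (rule dict_collapse[OF F _ l(1)]) (use N l ab in auto)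
  then obtain d where d: "d < N" "\<And>U' B'. part N U' {d} B' \<Longrightarrow> dict N F U' {d} B'"
    using dict_singleton[OF F N] by blast
  show False
  proof (cases "x d < l2")
    case True
    have D: "dict N F {d} ({..<N} - {d, b}) {b}"
      by (rule dict_collapse[OF F _ l(2)]) (use N ab d True in auto)
    then have "part N ({..<N} - {d, b}) {d} {b}"
      using part_swap_left[OF dict_part] by blast
    \<comment> \<open>With \<open>{b}\<close> on the right, \<open>{d}\<close> and the remaining
      agents would both be decisive.\<close>
    then show False using dict_unique_left[OF F D d(2)] by blast
  next
    case False
    have D: "dict N F {a} ({..<N} - {a, d}) {d}"
      by (rule dict_collapse[OF F _ l(1)]) (use N ab d l False in auto)
    then have "part N {a} {d} ({..<N} - {a, d})"
      using part_swap_right[OF dict_part] by blast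
    then show False using dict_unique_right[OF F D d(2)] by blast
  qed
qed

section \<open>From social cost to maximum cost\<close>

lemma OPT_nonneg: "0 \<le> OPT xs"
  unfolding OPT_def by (rule cInf_greatest) (auto intro!: sum_nonneg fcost_nonneg)

lemma OPT_le: "OPT xs \<le> (\<Sum>i<length xs. fcost L (xs ! i))"
  unfolding OPT_def
proof (rule cInf_lower)
  show "bdd_below {(\<Sum>i<length xs. fcost (l1, l2) (xs ! i)) |l1 l2. True}"
    by (rule bdd_belowI[of _ 0]) (auto intro!: sum_nonneg fcost_nonneg)
  show "(\<Sum>i<length xs. fcost L (xs ! i)) \<in> {(\<Sum>i<length xs. fcost (l1, l2) (xs ! i)) |l1 l2. True}"
    by (cases L) auto
qed

text \<open>One agent pays at most the social cost, and \<open>OPT\<close> is at most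
  \<open>n\<close> times any achievable maximum cost, so passing to the maximum loses a factor
  \<open>n\<close>.\<close>

lemma nice_niceN:
  assumes "nice n f"
  obtains \<Gamma> where "niceN n \<Gamma> (\<lambda>x. f (map x [0..<n]))"
proof -
  obtain \<gamma> where \<gamma>: "\<And>xs. length xs = n \<Longrightarrow> social_cost f xs \<le> \<gamma> * OPT xs"
    using assms by (auto simp: nice_def bounded_approx_def)
  have sp: "fcost (f xs) (xs ! i) \<le> fcost (f (xs[i := y])) (xs ! i)"
    if "length xs = n" "i < n" for xs i y
    using assms that by (auto simp: nice_def strategy_proof_def)
  define \<Gamma> where "\<Gamma> = max 1 (\<bar>\<gamma>\<bar> * real n)"
  have "niceN n \<Gamma> (\<lambda>x. f (map x [0..<n]))"
    unfolding niceN_def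
  proof (intro conjI allI impI)
    show "1 \<le> \<Gamma>" by (simp add: \<Gamma>_def)
    fix x y :: "nat \<Rightarrow> real" assume "\<forall>i<n. x i = y i"
    then show "f (map x [0..<n]) = f (map y [0..<n])" by (intro arg_cong[of _ _ f]) simp
  next
    fix x :: "nat \<Rightarrow> real" and y i assume i: "i < n"
    have "map (x(i := y)) [0..<n] = (map x [0..<n])[i := y]"
      by (rule nth_equalityI) (auto simp: nth_list_update)
    then show "fcost (f (map x [0..<n])) (x i) \<le> fcost (f (map (x(i := y)) [0..<n])) (x i)"
      using sp[of "map x [0..<n]" i y] i by simp
  next
    fix x :: "nat \<Rightarrow> real" and L r i assume r: "\<forall>i<n. fcost L (x i) \<le> r" and i: "i < n"
    let ?xs = "map x [0..<n]"
    have r0: "0 \<le> r" using r i fcost_nonneg[of L "x i"] by fastforce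
    have "fcost (f ?xs) (x i) = fcost (f ?xs) (?xs ! i)" using i by simp
    also have "\<dots> \<le> social_cost f ?xs"
      unfolding social_cost_def by (rule member_le_sum) (use i fcost_nonneg in auto)
    also have "\<dots> \<le> \<gamma> * OPT ?xs" using \<gamma>[of ?xs] by simp
    also have "\<dots> \<le> \<bar>\<gamma>\<bar> * OPT ?xs" using OPT_nonneg by (intro mult_right_mono) auto
    also have "\<dots> \<le> \<bar>\<gamma>\<bar> * (real n * r)"
    proof (rule mult_left_mono)
      have "OPT ?xs \<le> (\<Sum>i<n. fcost L (x i))" using OPT_le[of ?xs L] by simp
      also have "\<dots> \<le> (\<Sum>i<n. r)" using r by (intro sum_mono) auto
      finally show "OPT ?xs \<le> real n * r" by simp
    qed simp
    also have "\<dots> = (\<bar>\<gamma>\<bar> * real n) * r" by simp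
    also have "\<dots> \<le> \<Gamma> * r" using r0 by (intro mult_right_mono) (auto simp: \<Gamma>_def)
    finally show "fcost (f ?xs) (x i) \<le> \<Gamma> * r" .
  qed
  then show thesis by (rule that)
qed

theorem theorem1:
  fixes n :: nat and f :: "real list \<Rightarrow> real \<times> real"
  assumes "n \<ge> 5" and "nice n f"
  shows "\<forall>xs. length xs = n \<longrightarrow>
           (\<exists>l \<in> {fst (f xs), snd (f xs)}. l \<ge> Max (set xs) \<or> l \<le> Min (set xs))
           \<or> fst (f xs) = snd (f xs)"
proof (intro allI impI, rule ccontr)
  fix xs :: "real list" assume len: "length xs = n"
    and neg: "\<not> ((\<exists>l \<in> {fst (f xs), snd (f xs)}. l \<ge> Max (set xs) \<or> l \<le> Min (set xs))
           \<or> fst (f xs) = snd (f xs))"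
  obtain \<Gamma> where F: "niceN n \<Gamma> (\<lambda>x. f (map x [0..<n]))" using nice_niceN[OF assms(2)] .
  have fx: "f (map (\<lambda>i. xs ! i) [0..<n]) = f xs" using len map_nth[of xs] by simp
  have "set xs \<noteq> {}" using len assms(1) by auto
  then have "Min (set xs) \<in> set xs" "Max (set xs) \<in> set xs" by auto
  then obtain a b where ab: "a < n" "xs ! a = Min (set xs)" "b < n" "xs ! b = Max (set xs)"
    using len by (metis in_set_conv_nth)
  let ?l1 = "min (fst (f xs)) (snd (f xs))" and ?l2 = "max (fst (f xs)) (snd (f xs))"
  have "on (f xs) ?l1" "on (f xs) ?l2" by (auto simp: on_def min_def max_def)
  moreover have "?l1 < ?l2" "xs ! a < ?l1" "?l2 < xs ! b" using neg ab by auto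
  ultimately show False
    using no_interior_pair[OF F assms(1), of "\<lambda>i. xs ! i" ?l1 ?l2 a b] fx ab by simp
qed

end
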